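(* Let $p$ be a prime, let $l$ be an integer with $\gcd(p,l)=1$, and let $k$ be an integer. If $p$ is odd and $k\geq 1$, then $\Phi(p^k,2l)\,\Phi(p^k,-2l)=1$. If $p=2$ and $k\geq 3$, then $\Phi(p^k,2l)\,\Phi(p^k,-2l)=2$.
   Context: For integers $a,b$ with $a>0$, define the (normalized) quadratic Gauss sum $$\Phi(a,b)=\frac{1}{\sqrt{a}}\sum_{n=0}^{a-1}\exp\left(\frac{\pi i n^2 b}{a}\right),$$ where $i$ is the imaginary unit and $\sqrt{a}$ is the positive square root. Note the exponent contains $\pi i$, not $2\pi i$. *)

theory Defs
  imports Complex_Main "HOL-Computational_Algebra.Primes"
begin

(* The exponent is pi * i, not 2 * pi * i. Only a > 0 is meaningful; for a \<le> 0 the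
   index set is empty and the value is 0. *)
definition gauss_Phi :: "int \<Rightarrow> int \<Rightarrow> complex" where
  "gauss_Phi a b =
     1 / complex_of_real (sqrt (real_of_int a)) *
     (\<Sum>n = 0..a - 1. exp (complex_of_real pi * \<i> * of_int (n ^ 2) * of_int b / of_int a))"

end

(* Substituting m = d + n in the double sum over exp (2 pi i l (m^2 - n^2) / a) makes the
   exponent d^2 + 2 d n, which is linear in n. By orthogonality of characters only the d with
   a dvd 2 d survive: d = 0 for odd a, and d = 0, a / 2 for even a. *)

theory Submission
  imports Defs
begin

text \<open>The factor 2 in \<open>2 * l\<close> turns the \<open>pi * \<i>\<close> of
  \<open>gauss_Phi\<close> into \<open>2 * pi * \<i>\<close>, so the summands become values of a
  character of the integers mod \<open>a\<close>.\<close>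

definition add_char :: "int \<Rightarrow> int \<Rightarrow> int \<Rightarrow> complex" where
  "add_char a l n = cis (2 * pi * real_of_int (l * n) / real_of_int a)"

lemma add_char_0 [simp]: "add_char a l 0 = 1"
  by (simp add: add_char_def)

lemma add_char_add: "add_char a l (m + n) = add_char a l m * add_char a l n"
  by (simp add: add_char_def cis_mult algebra_simps add_divide_distrib)

lemma add_char_diff: "add_char a l (m - n) = add_char a l m * add_char a l (- n)"
  using add_char_add[of a l m "- n"] by simp

text \<open>Value 1 forces the angle to be a multiple of 2 pi, hence \<open>a dvd l * n\<close>, and
  coprimality cancels \<open>l\<close>. So the character is faithful on residues mod
  \<open>a\<close>.\<close>

lemma add_char_eq_1_iff:
  assumes "a > 0" "coprime a l"
  shows "add_char a l n = 1 \<longleftrightarrow> a dvd n"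
proof
  assume "add_char a l n = 1"
  then have "cos (2 * pi * real_of_int (l * n) / real_of_int a) = 1"
    by (simp add: add_char_def complex_eq_iff)
  then obtain z :: int where "2 * pi * real_of_int (l * n) / real_of_int a = real_of_int z * 2 * pi"
    unfolding cos_one_2pi_int by blast
  then have "real_of_int (l * n) = real_of_int (z * a)"
    using assms(1) by (simp add: field_simps)
  then have "a dvd l * n"
    by (metis dvd_triv_right of_int_eq_iff)
  then show "a dvd n"
    using assms(2) by (simp add: coprime_dvd_mult_right_iff)
next
  assume "a dvd n"
  then obtain c where "n = a * c" by blast
  then have "add_char a l n = cis (2 * pi * real_of_int (l * c))"
    using assms(1) by (simp add: add_char_def mult_ac)
  then show "add_char a l n = 1"
    by (simp only: cis_multiple_2pi[OF Ints_of_int])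
qed

lemma add_char_mod:
  assumes "a > 0" "coprime a l"
  shows "add_char a l (n + a * c) = add_char a l n"
  using add_char_eq_1_iff[OF assms, of "a * c"] by (simp add: add_char_add)

text \<open>Translation by \<open>s\<close> followed by reduction mod \<open>a\<close> permutes
  \<open>0..a - 1\<close>, and \<open>f\<close> depends only on the residue class.\<close>

lemma sum_periodic_shift:
  fixes f :: "int \<Rightarrow> 'a :: comm_monoid_add"
  assumes "a > 0" and f: "\<And>n c. f (n + a * c) = f n"
  shows "(\<Sum>n = 0..a - 1. f (n + s)) = (\<Sum>n = 0..a - 1. f n)"
proof (rule sum.reindex_bij_witness[where i = "\<lambda>n. (n - s) mod a" and j = "\<lambda>n. (n + s) mod a"])
  fix n
  show "f ((n + s) mod a) = f (n + s)"
    using f[of "(n + s) mod a" "(n + s) div a"] by simp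
qed (use assms(1) in \<open>auto simp: mod_simps\<close>)

text \<open>Orthogonality: shifting \<open>n\<close> by 1 leaves the sum unchanged but also
  multiplies it by \<open>add_char a l c\<close>. Unless \<open>a dvd c\<close>, this factor is not
  1, so the sum vanishes.\<close>

lemma sum_add_char:
  assumes "a > 0" "coprime a l"
  shows "(\<Sum>n = 0..a - 1. add_char a l (c * n)) = (if a dvd c then of_int a else 0)"
proof (cases "a dvd c")
  case True
  then have "add_char a l (c * n) = 1" for n
    using add_char_eq_1_iff[OF assms] by simp
  then show ?thesis
    using True assms(1) by simp
next
  case False
  let ?S = "\<Sum>n = 0..a - 1. add_char a l (c * n)"
  have "?S = (\<Sum>n = 0..a - 1. add_char a l (c * (n + 1)))"
    by (rule sum_periodic_shift[symmetric])
      (use assms add_char_mod[OF assms] in \<open>simp_all add: distrib_left mult.left_commute[of c a]\<close>)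
  also have "\<dots> = add_char a l c * ?S"
    by (simp add: sum_distrib_left distrib_left add_char_add mult.commute)
  finally show ?thesis
    using False add_char_eq_1_iff[OF assms, of c] by simp
qed

lemma gauss_Phi_double_conv_add_char:
  "gauss_Phi a (2 * l) = 1 / complex_of_real (sqrt (real_of_int a)) * (\<Sum>n = 0..a - 1. add_char a l (n\<^sup>2))"
  unfolding gauss_Phi_def add_char_def cis_conv_exp by (simp add: mult_ac)

text \<open>Common to both cases of the theorem: only the condition \<open>a dvd 2 * d\<close> still
  depends on the parity of \<open>a\<close>.\<close>

lemma gauss_Phi_mult_uminus:
  assumes "a > 0" "coprime a l"
  shows "gauss_Phi a (2 * l) * gauss_Phi a (- 2 * l) = (\<Sum>d | d \<in> {0..a - 1} \<and> a dvd 2 * d. add_char a l (d\<^sup>2))"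
proof -
  let ?e = "add_char a l" and ?I = "{0..a - 1}"
  have neg: "add_char a (- l) n = ?e (- n)" for n
    by (simp add: add_char_def)
  have "(\<Sum>m\<in>?I. ?e (m\<^sup>2)) * (\<Sum>n\<in>?I. ?e (- n\<^sup>2)) = (\<Sum>n\<in>?I. \<Sum>m\<in>?I. ?e (m\<^sup>2 - n\<^sup>2))"
    by (subst sum.swap) (simp add: sum_product add_char_diff)
  also have "\<dots> = (\<Sum>n\<in>?I. \<Sum>d\<in>?I. ?e ((d + n)\<^sup>2 - n\<^sup>2))"
  proof (rule sum.cong[OF refl])
    fix n
    \<comment> \<open>For fixed \<open>n\<close> the summand is periodic in \<open>m\<close>, so
      \<open>m\<close> may be replaced by \<open>d + n\<close> without changing the range.\<close>
    have "?e ((m + a * c)\<^sup>2 - n\<^sup>2) = ?e (m\<^sup>2 - n\<^sup>2)" for m c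
    proof -
      have "(m + a * c)\<^sup>2 - n\<^sup>2 = m\<^sup>2 - n\<^sup>2 + a * (2 * m * c + a * c\<^sup>2)"
        by (simp add: power2_eq_square algebra_simps)
      then show ?thesis
        by (simp only: add_char_mod[OF assms])
    qed
    then show "(\<Sum>m\<in>?I. ?e (m\<^sup>2 - n\<^sup>2)) = (\<Sum>d\<in>?I. ?e ((d + n)\<^sup>2 - n\<^sup>2))"
      by (rule sum_periodic_shift[OF assms(1), symmetric])
  qed
  also have "\<dots> = (\<Sum>n\<in>?I. \<Sum>d\<in>?I. ?e (d\<^sup>2) * ?e (2 * d * n))"
  proof (intro sum.cong refl)
    fix n d :: int
    have "(d + n)\<^sup>2 - n\<^sup>2 = d\<^sup>2 + 2 * d * n"
      by (simp add: power2_sum)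
    then show "?e ((d + n)\<^sup>2 - n\<^sup>2) = ?e (d\<^sup>2) * ?e (2 * d * n)"
      by (simp only: add_char_add)
  qed
  \<comment> \<open>With the sum over \<open>n\<close> innermost, orthogonality applies with
    \<open>c = 2 * d\<close>.\<close>
  also have "\<dots> = (\<Sum>d\<in>?I. ?e (d\<^sup>2) * (if a dvd 2 * d then of_int a else 0))"
    by (subst sum.swap) (simp add: sum_distrib_left[symmetric] sum_add_char[OF assms])
  also have "\<dots> = of_int a * (\<Sum>d | d \<in> ?I \<and> a dvd 2 * d. ?e (d\<^sup>2))"
    unfolding sum_distrib_left by (intro sum.mono_neutral_cong_right) auto
  finally have prod: "(\<Sum>m\<in>?I. ?e (m\<^sup>2)) * (\<Sum>n\<in>?I. ?e (- n\<^sup>2)) =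
      of_int a * (\<Sum>d | d \<in> ?I \<and> a dvd 2 * d. ?e (d\<^sup>2))" .
  have sqrt: "complex_of_real (sqrt (real_of_int a)) * complex_of_real (sqrt (real_of_int a)) = of_int a"
    using assms(1) by (simp flip: of_real_mult)
  \<comment> \<open>The form \<open>2 * - l\<close> lets
    \<open>gauss_Phi_double_conv_add_char\<close> apply to the second factor as well.\<close>
  have "gauss_Phi a (2 * l) * gauss_Phi a (2 * - l) =
      ((\<Sum>m\<in>?I. ?e (m\<^sup>2)) * (\<Sum>n\<in>?I. ?e (- n\<^sup>2))) /
      (complex_of_real (sqrt (real_of_int a)) * complex_of_real (sqrt (real_of_int a)))"
    unfolding gauss_Phi_double_conv_add_char neg by simp
  then show ?thesis
    unfolding prod sqrt using assms(1) by simp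
qed

lemma gauss_Phi_mult_uminus_odd:
  assumes "a > 0" "coprime a l" "odd a"
  shows "gauss_Phi a (2 * l) * gauss_Phi a (- 2 * l) = 1"
proof -
  have "a dvd 2 * d \<longleftrightarrow> a dvd d" for d
    using assms(3) by (simp add: coprime_dvd_mult_right_iff)
  moreover have "d = 0" if "0 \<le> d" "d \<le> a - 1" "a dvd d" for d
    using that zdvd_not_zless[of d a] by linarith
  ultimately have "{d. d \<in> {0..a - 1} \<and> a dvd 2 * d} = {0}"
    using assms(1) by auto
  then show ?thesis
    unfolding gauss_Phi_mult_uminus[OF assms(1,2)] by simp
qed

text \<open>Both \<open>d = 0\<close> and \<open>d = a / 2\<close> contribute 1, since
  \<open>4 dvd a\<close> makes (a/2)^2 = a * (a/4) a multiple of \<open>a\<close>. For a = 2 mod 4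
  the second term would be -1 and the product 0.\<close>

lemma gauss_Phi_mult_uminus_4_dvd:
  assumes "a > 0" "coprime a l" "4 dvd a"
  shows "gauss_Phi a (2 * l) * gauss_Phi a (- 2 * l) = 2"
proof -
  obtain b where a: "a = 4 * b"
    using assms(3) by blast
  have "d = 0 \<or> d = 2 * b" if "0 \<le> d" "d < a" "a dvd 2 * d" for d
  proof -
    obtain c where c: "2 * d = a * c"
      using \<open>a dvd 2 * d\<close> by blast
    \<comment> \<open>Since 0 \<le> 2d < 2a, the cofactor \<open>c\<close> can only be 0 or
      1.\<close>
    have "0 \<le> a * c" "a * c < a * 2"
      using c that by linarith+
    then have "0 \<le> c" "c < 2"
      using assms(1) by (simp_all add: zero_le_mult_iff)
    then have "c = 0 \<or> c = 1"
      by linarith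
    then show ?thesis
      using c a by auto
  qed
  then have "{d. d \<in> {0..a - 1} \<and> a dvd 2 * d} = {0, 2 * b}"
    using assms(1) a by auto
  moreover have "add_char a l ((2 * b)\<^sup>2) = 1"
    using add_char_eq_1_iff[OF assms(1,2)] a by (simp add: power2_eq_square)
  ultimately show ?thesis
    using assms(1) a unfolding gauss_Phi_mult_uminus[OF assms(1,2)] by simp
qed

theorem proposition1:
  fixes p l :: int and k :: nat
  assumes "prime p" and "gcd p l = 1"
  shows "(odd p \<and> k \<ge> 1 \<longrightarrow> gauss_Phi (p ^ k) (2 * l) * gauss_Phi (p ^ k) (- 2 * l) = 1) \<and>
         (p = 2 \<and> k \<ge> 3 \<longrightarrow> gauss_Phi (p ^ k) (2 * l) * gauss_Phi (p ^ k) (- 2 * l) = 2)"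
proof -
  have pos: "p ^ k > 0"
    using assms(1) by (simp add: prime_gt_0_int)
  have cop: "coprime (p ^ k) l"
    using assms(2) by (simp flip: coprime_iff_gcd_eq_1)
  have "4 dvd p ^ k" if "p = 2" "k \<ge> 3"
    using le_imp_power_dvd[of 2 k "2 :: int"] that by simp
  then show ?thesis
    using gauss_Phi_mult_uminus_odd[OF pos cop] gauss_Phi_mult_uminus_4_dvd[OF pos cop] even_power by blast
qed

end
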